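(* Let $\mathcal{H}$ be a complex Hilbert space. If $E\subseteq\mathcal{H}$ is such that the functions $(\ell_v)_{v\in E}$, $\ell_v(A):=\langle Av,v\rangle$, separate the points of $\operatorname{Herm}_1(\mathcal{H})$, then the functions $(h_v)_{v\in E}$, $h_v([x]):=|\langle v,x\rangle|$, separate the points of $\overline{\mathbb{P}}(\mathcal{H})$. In particular, the topology on $\mathbb{P}(\mathcal{H})$ is the initial topology with respect to $(h_v)_{v\in E}$.
   Context: $\operatorname{Herm}_1(\mathcal{H})$ is the real Banach space of hermitian trace class operators on $\mathcal{H}$. $\mathbb{S}(\mathcal{H})=\{v\in\mathcal{H}:\|v\|=1\}$ carries the norm topology, $\mathbb{T}=\{z\in\mathbb{C}:|z|=1\}$, and $\mathbb{P}(\mathcal{H})=\mathbb{S}(\mathcal{H})/\mathbb{T}$ (the space of one-dimensional subspaces $[v]$) carries the quotient topology. $\overline{\mathbb{S}}(\mathcal{H})=\{v\in\mathcal{H}:\|v\|\le 1\}$ is the closed unit ball with the weak topology, and $\overline{\mathbb{P}}(\mathcal{H}):=\overline{\mathbb{S}}(\mathcal{H})/\mathbb{T}$ is the quotient space, with elements $[x]=\mathbb{T}x$; $\mathbb{P}(\mathcal{H})$ is viewed as a subset of $\overline{\mathbb{P}}(\mathcal{H})$, so $h_v$ is evaluated on $\mathbb{P}(\mathcal{H})$ using unit representatives. *)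

theory Defs
  imports "HOL-Analysis.Analysis"
begin

section \<open>Complex Hilbert spaces\<close>

text \<open>The inner product is linear in the first argument. There is no separate positivity axiom:
  it is part of \<open>norm_cinner\<close>.\<close>

class complex_inner = real_normed_vector +
  fixes scaleC :: "complex \<Rightarrow> 'a \<Rightarrow> 'a" (infixr "*\<^sub>C" 75)
    and cinner :: "'a \<Rightarrow> 'a \<Rightarrow> complex"
  assumes scaleC_add_right: "a *\<^sub>C (x + y) = a *\<^sub>C x + a *\<^sub>C y"
    and scaleC_add_left: "(a + b) *\<^sub>C x = a *\<^sub>C x + b *\<^sub>C x"
    and scaleC_scaleC: "a *\<^sub>C b *\<^sub>C x = (a * b) *\<^sub>C x"
    and scaleC_of_real: "complex_of_real r *\<^sub>C x = r *\<^sub>R x"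
    and cinner_add_left: "cinner (x + y) z = cinner x z + cinner y z"
    and cinner_scaleC_left: "cinner (a *\<^sub>C x) y = a * cinner x y"
    and cinner_commute: "cinner y x = cnj (cinner x y)"
    and norm_cinner: "cinner x x = complex_of_real ((norm x)\<^sup>2)"

class complex_hilbert_space = complex_inner + complete_space

instantiation complex :: complex_hilbert_space
begin

definition scaleC_complex :: "complex \<Rightarrow> complex \<Rightarrow> complex"
  where "scaleC_complex a x = a * x"

definition cinner_complex :: "complex \<Rightarrow> complex \<Rightarrow> complex"
  where "cinner_complex x y = x * cnj y"

instance
proof
  fix x :: complex
  show "cinner x x = complex_of_real ((norm x)\<^sup>2)"
    unfolding cinner_complex_def by (rule complex_norm_square[symmetric])
qed (simp_all add: scaleC_complex_def cinner_complex_def algebra_simps scaleR_conv_of_real)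

end


section \<open>Hermitian trace class operators\<close>

definition bounded_clinear :: "('a::complex_inner \<Rightarrow> 'b::complex_inner) \<Rightarrow> bool"
  where "bounded_clinear T \<longleftrightarrow> bounded_linear T \<and> (\<forall>c x. T (c *\<^sub>C x) = c *\<^sub>C T x)"

definition is_cadjoint :: "('a::complex_inner \<Rightarrow> 'a) \<Rightarrow> ('a \<Rightarrow> 'a) \<Rightarrow> bool"
  where "is_cadjoint T S \<longleftrightarrow> (\<forall>x y. cinner (T x) y = cinner x (S y))"

definition hermitian_op :: "('a::complex_inner \<Rightarrow> 'a) \<Rightarrow> bool"
  where "hermitian_op T \<longleftrightarrow> bounded_clinear T \<and> is_cadjoint T T"

definition positive_op :: "('a::complex_inner \<Rightarrow> 'a) \<Rightarrow> bool"
  where "positive_op T \<longleftrightarrow> bounded_clinear T \<and> (\<forall>x. cinner (T x) x \<in> \<real>\<^sub>\<ge>\<^sub>0)"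

text \<open>\<open>is_abs_op T P\<close> says that \<open>P\<close> is the (unique) positive square root \<open>|T|\<close> of \<open>T\<^sup>*T\<close>.\<close>

definition is_abs_op :: "('a::complex_inner \<Rightarrow> 'a) \<Rightarrow> ('a \<Rightarrow> 'a) \<Rightarrow> bool"
  where "is_abs_op T P \<longleftrightarrow> positive_op P \<and> (\<exists>S. is_cadjoint T S \<and> P \<circ> P = S \<circ> T)"

text \<open>A Hilbert space basis, i.e. a maximal orthonormal set.\<close>

definition orthonormal_basis :: "'a::complex_inner set \<Rightarrow> bool"
  where "orthonormal_basis B \<longleftrightarrow>
    (\<forall>b\<in>B. norm b = 1) \<and> (\<forall>b\<in>B. \<forall>c\<in>B. b \<noteq> c \<longrightarrow> cinner b c = 0) \<and>
    (\<forall>x. (\<forall>b\<in>B. cinner x b = 0) \<longrightarrow> x = 0)"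

text \<open>\<open>T\<close> is trace class if \<open>|T|\<close> has finite trace with respect to some (equivalently, every)
  orthonormal basis.\<close>

definition trace_class :: "('a::complex_inner \<Rightarrow> 'a) \<Rightarrow> bool"
  where "trace_class T \<longleftrightarrow> bounded_clinear T \<and>
    (\<exists>P B. is_abs_op T P \<and> orthonormal_basis B \<and> (\<lambda>b. cinner (P b) b) summable_on B)"

definition Herm1 :: "('a::complex_hilbert_space \<Rightarrow> 'a) set"
  where "Herm1 = {A. hermitian_op A \<and> trace_class A}"

definition ell :: "'a::complex_hilbert_space \<Rightarrow> ('a \<Rightarrow> 'a) \<Rightarrow> complex"
  where "ell v A = cinner (A v) v"


section \<open>Separation of points, initial and quotient topologies\<close>

definition separates_points_on :: "'x set \<Rightarrow> 'i set \<Rightarrow> ('i \<Rightarrow> 'x \<Rightarrow> 'y) \<Rightarrow> bool"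
  where "separates_points_on X I f \<longleftrightarrow> (\<forall>x\<in>X. \<forall>y\<in>X. x \<noteq> y \<longrightarrow> (\<exists>i\<in>I. f i x \<noteq> f i y))"

text \<open>The coarsest topology on \<open>X\<close> making all \<open>f i\<close> (\<open>i \<in> I\<close>) continuous, given by its standard
  subbasis; \<open>X\<close> itself is inserted so that the underlying set is \<open>X\<close> even if \<open>I\<close> is empty.\<close>

definition initial_topology ::
    "'x set \<Rightarrow> 'i set \<Rightarrow> ('i \<Rightarrow> 'x \<Rightarrow> 'y::topological_space) \<Rightarrow> 'x topology"
  where "initial_topology X I f =
    topology_generated_by (insert X {X \<inter> f i -` U | i U. i \<in> I \<and> open U})"

definition quotient_topology :: "'x topology \<Rightarrow> ('x \<Rightarrow> 'y) \<Rightarrow> 'y topology"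
  where "quotient_topology X q =
    topology (\<lambda>U. U \<subseteq> q ` topspace X \<and> openin X {x \<in> topspace X. q x \<in> U})"

lemma openin_quotient_topology:
  "openin (quotient_topology X q) U \<longleftrightarrow>
    U \<subseteq> q ` topspace X \<and> openin X {x \<in> topspace X. q x \<in> U}"
proof -
  let ?L = "\<lambda>U. U \<subseteq> q ` topspace X \<and> openin X {x \<in> topspace X. q x \<in> U}"
  have "istopology ?L"
    unfolding istopology_def
  proof (intro conjI allI impI)
    fix S T assume "?L S" "?L T"
    moreover have "{x \<in> topspace X. q x \<in> S \<inter> T} =
        {x \<in> topspace X. q x \<in> S} \<inter> {x \<in> topspace X. q x \<in> T}"
      by auto
    ultimately show "S \<inter> T \<subseteq> q ` topspace X" "openin X {x \<in> topspace X. q x \<in> S \<inter> T}"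
      by auto
  next
    fix K assume K: "\<forall>S\<in>K. ?L S"
    have "{x \<in> topspace X. q x \<in> \<Union>K} = (\<Union>S\<in>K. {x \<in> topspace X. q x \<in> S})"
      by auto
    with K show "\<Union>K \<subseteq> q ` topspace X" "openin X {x \<in> topspace X. q x \<in> \<Union>K}"
      by auto
  qed
  then show ?thesis
    by (simp add: quotient_topology_def topology_inverse')
qed

lemma quotient_map_quotient_topology: "quotient_map X (quotient_topology X q) q"
proof -
  have eq: "{x \<in> topspace X. q x \<in> q ` topspace X} = topspace X"
    by auto
  have "topspace (quotient_topology X q) \<subseteq> q ` topspace X"
    using openin_topspace[of "quotient_topology X q"] unfolding openin_quotient_topology
    by (rule conjunct1)
  moreover have "openin (quotient_topology X q) (q ` topspace X)"
    unfolding openin_quotient_topology eq by simp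
  then have "q ` topspace X \<subseteq> topspace (quotient_topology X q)"
    by (rule openin_subset)
  ultimately have "q ` topspace X = topspace (quotient_topology X q)"
    by (rule equalityI[rotated])
  then show ?thesis
    unfolding quotient_map_def openin_quotient_topology by blast
qed


section \<open>Projective space\<close>

text \<open>The class \<open>[x] = \<T>x\<close>, as a set of vectors. A point of projective space is represented by
  the set of its unit representatives, so that \<open>proj_space \<subseteq> closed_proj_space\<close> holds literally.\<close>

definition ray :: "'a::complex_hilbert_space \<Rightarrow> 'a set"
  where "ray x = {z *\<^sub>C x | z. cmod z = 1}"

definition proj_space :: "'a::complex_hilbert_space set set"
  where "proj_space = ray ` sphere 0 1"

definition closed_proj_space :: "'a::complex_hilbert_space set set"
  where "closed_proj_space = ray ` cball 0 1"

definition proj_topology :: "'a::complex_hilbert_space set topology"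
  where "proj_topology = quotient_topology (top_of_set (sphere 0 1)) ray"

text \<open>The modulus is constant on each class (lemma \<open>h_fun_ray\<close>), so the image below is a
  singleton.\<close>

definition h_fun :: "'a::complex_hilbert_space \<Rightarrow> 'a set \<Rightarrow> real"
  where "h_fun v p = the_elem ((\<lambda>x. cmod (cinner v x)) ` p)"

lemma h_fun_ray: "h_fun v (ray x) = cmod (cinner v x)"
proof -
  have *: "cmod (cinner v (z *\<^sub>C x)) = cmod z * cmod (cinner v x)" for z
  proof -
    have "cinner v (z *\<^sub>C x) = cnj (z * cinner x v)"
      by (subst cinner_commute) (simp only: cinner_scaleC_left)
    also have "cinner x v = cnj (cinner v x)"
      by (rule cinner_commute)
    finally show ?thesis
      by (simp add: norm_mult)
  qed
  have "(\<lambda>x. cmod (cinner v x)) ` ray x = {cmod (cinner v x)}"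
  proof
    show "(\<lambda>x. cmod (cinner v x)) ` ray x \<subseteq> {cmod (cinner v x)}"
      by (auto simp: ray_def *)
    have "1 *\<^sub>C x \<in> ray x"
      unfolding ray_def by force
    then have "cmod (cinner v (1 *\<^sub>C x)) \<in> (\<lambda>x. cmod (cinner v x)) ` ray x"
      by (rule imageI)
    then show "{cmod (cinner v x)} \<subseteq> (\<lambda>x. cmod (cinner v x)) ` ray x"
      by (simp add: *)
  qed
  then show ?thesis
    by (simp add: h_fun_def)
qed

end

theory Submission
  imports Defs
begin

text \<open>Let \<open>R\<^sub>x u = \<langle>u, x\<rangle> x\<close>. This operator is positive of rank one, hence trace class, it
  determines the ray of \<open>x\<close>, and \<open>\<langle>R\<^sub>x v, v\<rangle> = \<bar>\<langle>v, x\<rangle>\<bar>\<^sup>2\<close>; so a family that separates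
  hermitian trace class operators separates rays.

  For the topologies, fix a unit vector \<open>x\<^sub>0\<close>. The map \<open>x \<mapsto> \<langle>\<cdot>, x\<rangle>\<close> embeds the weak unit ball
  in a product of discs, where its image is compact by Tychonoff and Riesz. A point \<open>y\<close> of the ball
  with \<open>\<bar>\<langle>v, y\<rangle>\<bar> = \<bar>\<langle>v, x\<^sub>0\<rangle>\<bar>\<close> for all \<open>v \<in> E\<close> lies in the ray of \<open>x\<^sub>0\<close>, so by compactness
  finitely many conditions \<open>\<bar>\<langle>v, x\<rangle>\<bar> \<approx> \<bar>\<langle>v, x\<^sub>0\<rangle>\<bar>\<close> force \<open>\<bar>\<langle>x\<^sub>0, x\<rangle>\<bar>\<close> to be close to 1. For a
  unit vector \<open>x\<close> this means that some \<open>cx\<close> with \<open>\<bar>c\<bar> = 1\<close> is close to \<open>x\<^sub>0\<close> in norm.\<close>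

section \<open>Inner product basics\<close>

lemma scaleC_one: "1 *\<^sub>C x = (x::'a::complex_inner)"
  using scaleC_of_real[of 1 x] by simp

lemma cinner_scaleR_left: "cinner (r *\<^sub>R x) y = of_real r * cinner x y"
  by (simp add: scaleC_of_real[symmetric] cinner_scaleC_left)

lemma cinner_add_right: "cinner x (y + z) = cinner x y + cinner x z"
  by (metis cinner_add_left cinner_commute complex_cnj_add)

lemma cinner_scaleC_right: "cinner x (c *\<^sub>C y) = cnj c * cinner x y"
  by (metis cinner_scaleC_left cinner_commute complex_cnj_mult)

lemma cinner_scaleR_right: "cinner x (r *\<^sub>R y) = of_real r * cinner x y"
  by (simp add: scaleC_of_real[symmetric] cinner_scaleC_right)

lemma cinner_zero_left [simp]: "cinner 0 x = 0"
  using cinner_add_left[of 0 0 x] by simp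

lemma cinner_zero_right [simp]: "cinner x 0 = 0"
  using cinner_add_right[of x 0 0] by simp

lemma cinner_diff_left: "cinner (x - y) z = cinner x z - cinner y z"
  by (metis add_diff_cancel diff_add_cancel cinner_add_left)

lemma cinner_diff_right: "cinner x (y - z) = cinner x y - cinner x z"
  by (metis add_diff_cancel diff_add_cancel cinner_add_right)

lemma cmod_cinner_commute: "cmod (cinner x y) = cmod (cinner y x)"
  by (metis cinner_commute complex_mod_cnj)

lemma of_real_cmod_square: "(complex_of_real (cmod z))\<^sup>2 = z * cnj z"
  by (metis complex_norm_square of_real_power)

lemma norm_scaleC: "norm (c *\<^sub>C x) = cmod c * norm (x::'a::complex_inner)"
proof -
  have "complex_of_real ((norm (c *\<^sub>C x))\<^sup>2) = of_real ((cmod c * norm x)\<^sup>2)"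
    unfolding norm_cinner[symmetric] cinner_scaleC_left cinner_scaleC_right power_mult_distrib
    by (simp add: norm_cinner of_real_cmod_square power_mult_distrib)
  then have "(norm (c *\<^sub>C x))\<^sup>2 = (cmod c * norm x)\<^sup>2"
    using of_real_eq_iff by blast
  then show ?thesis
    by (simp add: power2_eq_iff_nonneg)
qed

lemma norm_add_square:
  "(norm (x + y))\<^sup>2 = (norm x)\<^sup>2 + (norm y)\<^sup>2 + 2 * Re (cinner x (y::'a::complex_inner))"
proof -
  have "complex_of_real ((norm (x + y))\<^sup>2) =
      of_real ((norm x)\<^sup>2) + of_real ((norm y)\<^sup>2) + (cinner x y + cnj (cinner x y))"
    unfolding norm_cinner[symmetric]
    by (simp add: cinner_add_left cinner_add_right cinner_commute[of x y])
  then have "Re (complex_of_real ((norm (x + y))\<^sup>2)) =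
      Re (of_real ((norm x)\<^sup>2) + of_real ((norm y)\<^sup>2) + (cinner x y + cnj (cinner x y)))"
    by (rule arg_cong)
  then show ?thesis
    by simp
qed

lemma norm_diff_square:
  "(norm (x - y))\<^sup>2 = (norm x)\<^sup>2 + (norm y)\<^sup>2 - 2 * Re (cinner x (y::'a::complex_inner))"
proof -
  have "cinner x (- y) = - cinner x y"
    using cinner_diff_right[of x 0 y] by simp
  then show ?thesis
    using norm_add_square[of x "- y"] by simp
qed

lemma parallelogram_law:
  "(norm (x + y))\<^sup>2 + (norm (x - y))\<^sup>2 = 2 * (norm x)\<^sup>2 + 2 * (norm (y::'a::complex_inner))\<^sup>2"
  by (simp add: norm_add_square norm_diff_square)

text \<open>Rotating one argument by this phase makes an inner product real and nonnegative, so its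
  modulus appears as the real part in \<open>norm_diff_square\<close>.\<close>

lemma ex_phase: "\<exists>c. cmod c = 1 \<and> c * z = of_real (cmod z)"
proof (cases "z = 0")
  case False
  then show ?thesis
    by (intro exI[of _ "cnj z / of_real (cmod z)"])
       (simp add: norm_divide complex_norm_square[symmetric] mult.commute power2_eq_square
         field_simps flip: of_real_mult)
qed (auto intro: exI[of _ 1])

text \<open>Cauchy-Schwarz. With a phase \<open>c\<close> from \<open>ex_phase\<close>, the squared
  norm of \<open>norm y *\<^sub>R c *\<^sub>C x - norm x *\<^sub>R y\<close> is the desired
  difference times a factor that is positive for nonzero vectors.\<close>

lemma cmod_cinner_le: "cmod (cinner x y) \<le> norm x * norm (y::'a::complex_inner)"
proof (cases "x = 0 \<or> y = 0")
  case False
  obtain c where c: "cmod c = 1" "c * cinner x y = of_real (cmod (cinner x y))"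
    using ex_phase by blast
  have "0 \<le> (norm (norm y *\<^sub>R c *\<^sub>C x - norm x *\<^sub>R y))\<^sup>2"
    by simp
  also have "\<dots> = 2 * (norm x * norm y) * (norm x * norm y - cmod (cinner x y))"
    unfolding norm_diff_square
    by (simp add: norm_scaleC c cinner_scaleR_left cinner_scaleR_right
        cinner_scaleC_left power2_eq_square algebra_simps)
  finally show ?thesis
    using False by (simp add: zero_le_mult_iff mult_le_0_iff)
qed auto

lemma bounded_linear_cinner_left: "bounded_linear (\<lambda>x. cinner x (y::'a::complex_inner))"
  by (rule bounded_linear_intro[of _ "norm y"])
     (auto simp: cinner_add_left cinner_scaleR_left cmod_cinner_le scaleR_conv_of_real)

lemma bounded_linear_cinner_right: "bounded_linear (\<lambda>y. cinner x (y::'a::complex_inner))"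
  by (rule bounded_linear_intro[of _ "norm x"])
     (auto simp: cinner_add_right cinner_scaleR_right scaleR_conv_of_real
       cmod_cinner_le[of x, THEN order_trans] mult.commute)


section \<open>Rank-one operators\<close>

text \<open>This is the orthogonal projection onto the span of \<open>x\<close>, scaled by the
  squared norm of \<open>x\<close>.\<close>

definition rank_one :: "'a::complex_inner \<Rightarrow> 'a \<Rightarrow> 'a"
  where "rank_one x u = cinner u x *\<^sub>C x"

lemma bounded_clinear_rank_one: "bounded_clinear (rank_one x)"
proof -
  have "bounded_linear (rank_one x)"
  proof (rule bounded_linear_intro[of _ "norm x * norm x"])
    show "norm (rank_one x u) \<le> norm u * (norm x * norm x)" for u
      using mult_right_mono[OF cmod_cinner_le[of u x], of "norm x"]
      by (simp add: rank_one_def norm_scaleC mult.assoc)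
  qed (simp_all add: rank_one_def cinner_add_left cinner_scaleR_left scaleC_add_left
      scaleC_of_real scaleC_scaleC[symmetric])
  then show ?thesis
    by (simp add: bounded_clinear_def rank_one_def cinner_scaleC_left scaleC_scaleC)
qed

lemma cinner_rank_one: "cinner (rank_one x u) v = cinner u x * cnj (cinner v x)"
  by (simp add: rank_one_def cinner_scaleC_left cinner_commute[of x v])

lemma cinner_rank_one_self: "cinner (rank_one x u) u = of_real ((cmod (cinner u x))\<^sup>2)"
  by (simp add: cinner_rank_one of_real_cmod_square)

lemma hermitian_op_rank_one: "hermitian_op (rank_one x)"
proof -
  have "is_cadjoint (rank_one x) (rank_one x)"
    unfolding is_cadjoint_def
    by (metis cinner_commute cinner_rank_one complex_cnj_cnj complex_cnj_mult mult.commute)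
  then show ?thesis
    by (simp add: hermitian_op_def bounded_clinear_rank_one)
qed

text \<open>A positive self-adjoint operator is its own absolute value; the adjoint required by
  \<open>is_abs_op\<close> is the operator itself.\<close>

lemma is_abs_op_rank_one: "is_abs_op (rank_one x) (rank_one x)"
  using hermitian_op_rank_one[of x]
  by (auto simp: is_abs_op_def positive_op_def hermitian_op_def cinner_rank_one_self)

text \<open>Zorn's lemma on the orthonormal sets containing \<open>e\<close>: a nonzero vector
  orthogonal to a maximal one could be normalised and added to it.\<close>

lemma ex_orthonormal_basis_containing:
  assumes "norm (e::'a::complex_inner) = 1"
  shows "\<exists>B. orthonormal_basis B \<and> e \<in> B"
proof -
  let ?ON = "{B. (\<forall>b\<in>B. norm b = 1) \<and> (\<forall>b\<in>B. \<forall>c\<in>B. b \<noteq> c \<longrightarrow> cinner b c = 0) \<and> e \<in> B}"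
  have "\<exists>M\<in>?ON. \<forall>X\<in>?ON. M \<subseteq> X \<longrightarrow> X = M"
  proof (rule subset_Zorn_nonempty)
    have "{e} \<in> ?ON"
      using assms by auto
    then show "?ON \<noteq> {}"
      by blast
  next
    fix C assume C: "C \<noteq> {}" "subset.chain ?ON C"
    then have sub: "\<And>X. X \<in> C \<Longrightarrow> X \<in> ?ON" and tot: "\<And>X Y. X \<in> C \<Longrightarrow> Y \<in> C \<Longrightarrow> X \<subseteq> Y \<or> Y \<subseteq> X"
      by (auto simp: subset_chain_def)
    have "cinner b c = 0" if bc: "b \<in> \<Union>C" "c \<in> \<Union>C" "b \<noteq> c" for b c
    proof -
      \<comment> \<open>Orthogonality concerns two vectors at a time, and in a chain both lie in a
        common member.\<close>
      obtain X Y where "X \<in> C" "Y \<in> C" "b \<in> X" "c \<in> Y"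
        using bc(1,2) by blast
      moreover from this have "X \<subseteq> Y \<or> Y \<subseteq> X"
        using tot by blast
      ultimately obtain Z where "Z \<in> C" "b \<in> Z" "c \<in> Z"
        by blast
      then show ?thesis
        using sub[of Z] \<open>b \<noteq> c\<close> by blast
    qed
    moreover have "norm b = 1" if "b \<in> \<Union>C" for b
      using that sub by blast
    moreover have "e \<in> \<Union>C"
      using sub C(1) by blast
    ultimately show "\<Union>C \<in> ?ON"
      unfolding mem_Collect_eq by (intro conjI ballI impI)
  qed
  then obtain M where M: "M \<in> ?ON" and M_max: "\<forall>X\<in>?ON. M \<subseteq> X \<longrightarrow> X = M"
    by (rule bexE)
  have max: "X = M" if "X \<in> ?ON" "M \<subseteq> X" for X
    using M_max[THEN bspec, OF that(1)] that(2) by (rule mp)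
  have "x = 0" if x: "\<forall>b\<in>M. cinner x b = 0" for x
  proof (rule ccontr)
    assume "x \<noteq> 0"
    let ?y = "(1 / norm x) *\<^sub>R x"
    have y: "norm ?y = 1" "\<And>b. b \<in> M \<Longrightarrow> cinner ?y b = 0"
      using \<open>x \<noteq> 0\<close> x by (auto simp: cinner_scaleR_left)
    moreover have "\<And>b. b \<in> M \<Longrightarrow> cinner b ?y = 0"
      using y(2) by (metis cinner_commute complex_cnj_zero)
    ultimately have "insert ?y M \<in> ?ON"
      using M by auto
    then have "insert ?y M = M"
      by (rule max) (rule subset_insertI)
    then have "?y \<in> M"
      by (rule subst) (rule insertI1)
    then have "cinner ?y ?y = 0"
      using y(2) by blast
    then show False
      using y(1) by (simp add: norm_cinner)
  qed
  then show ?thesis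
    using M by (auto simp: orthonormal_basis_def)
qed

text \<open>In such a basis the trace of \<open>rank_one x\<close> has at most one nonzero term. For
  \<open>x\<close> nonzero, any basis through the normalised \<open>x\<close> works, since its other
  members are orthogonal to \<open>x\<close>. For \<open>x = 0\<close> any basis works, and in the
  zero space the empty one.\<close>

lemma ex_orthonormal_basis_one_nonorthogonal:
  "\<exists>B. orthonormal_basis B \<and>
    (\<forall>b\<in>B. \<forall>c\<in>B. cinner b x \<noteq> 0 \<longrightarrow> cinner c (x::'a::complex_inner) \<noteq> 0 \<longrightarrow> b = c)"
proof (cases "x = 0")
  case True
  show ?thesis
  proof (cases "\<exists>y::'a. y \<noteq> 0")
    case True
    then obtain y :: 'a where "y \<noteq> 0"
      by blast
    then have "norm ((1 / norm y) *\<^sub>R y) = 1"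
      by simp
    then show ?thesis
      using ex_orthonormal_basis_containing \<open>x = 0\<close> by fastforce
  next
    case False
    then have "orthonormal_basis ({} :: 'a set)"
      by (auto simp: orthonormal_basis_def)
    then show ?thesis
      by blast
  qed
next
  case False
  let ?e = "(1 / norm x) *\<^sub>R x"
  have "norm ?e = 1"
    using False by simp
  then obtain B where B: "orthonormal_basis B" "?e \<in> B"
    using ex_orthonormal_basis_containing by blast
  have "b = ?e" if "b \<in> B" "cinner b x \<noteq> 0" for b
    using that B False unfolding orthonormal_basis_def
    by (metis cinner_scaleR_right mult_eq_0_iff of_real_eq_0_iff divide_eq_0_iff norm_eq_zero zero_neq_one)
  then show ?thesis
    using B(1) by metis
qed

lemma rank_one_in_Herm1: "rank_one x \<in> Herm1"
proof -
  obtain B where B: "orthonormal_basis B"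
    "\<And>b c. b \<in> B \<Longrightarrow> c \<in> B \<Longrightarrow> cinner b x \<noteq> 0 \<Longrightarrow> cinner c x \<noteq> 0 \<Longrightarrow> b = c"
    using ex_orthonormal_basis_one_nonorthogonal[of x] by blast
  let ?S = "{b \<in> B. cinner b x \<noteq> 0}"
  have "finite ?S"
  proof (cases "?S = {}")
    case True
    then show ?thesis
      by (simp only: finite.emptyI)
  next
    case False
    then obtain b where "b \<in> ?S"
      by blast
    then have "?S \<subseteq> {b}"
      using B(2) by blast
    then show ?thesis
      by (rule finite_subset) simp
  qed
  then have "(\<lambda>b. cinner (rank_one x b) b) summable_on ?S"
    by simp
  then have "(\<lambda>b. cinner (rank_one x b) b) summable_on B"
    by (subst summable_on_cong_neutral[of ?S B]) (auto simp: cinner_rank_one)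
  then have "trace_class (rank_one x)"
    unfolding trace_class_def using bounded_clinear_rank_one is_abs_op_rank_one B(1) by blast
  then show ?thesis
    by (simp add: Herm1_def hermitian_op_rank_one)
qed


section \<open>Separation of rays\<close>

lemma ray_scaleC:
  assumes "cmod c = 1"
  shows "ray (c *\<^sub>C x) = ray x"
proof
  show "ray (c *\<^sub>C x) \<subseteq> ray x"
    using assms by (force simp: ray_def scaleC_scaleC norm_mult)
  show "ray x \<subseteq> ray (c *\<^sub>C x)"
  proof
    fix y assume "y \<in> ray x"
    then obtain z where "y = z *\<^sub>C x" "cmod z = 1"
      by (auto simp: ray_def)
    moreover have "c \<noteq> 0"
      using assms by auto
    ultimately have "y = (z / c) *\<^sub>C c *\<^sub>C x" "cmod (z / c) = 1"
      using assms by (simp_all add: scaleC_scaleC norm_divide)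
    then show "y \<in> ray (c *\<^sub>C x)"
      unfolding ray_def by blast
  qed
qed

text \<open>The quadratic form of \<open>rank_one x\<close> determines all moduli
  \<open>cmod (cinner u x)\<close>, so \<open>x\<close> and \<open>y\<close> vanish together.
  Otherwise, evaluating the operators at \<open>x\<close> shows that \<open>y\<close> is a multiple
  of \<open>x\<close>, and the moduli at \<open>u = x\<close> show that the factor is a
  phase.\<close>

lemma ray_eq_if_rank_one_eq:
  assumes "rank_one x = rank_one y"
  shows "ray x = ray (y::'a::complex_hilbert_space)"
proof -
  have *: "cmod (cinner u x) = cmod (cinner u y)" for u
  proof -
    have "complex_of_real ((cmod (cinner u x))\<^sup>2) = of_real ((cmod (cinner u y))\<^sup>2)"
      unfolding cinner_rank_one_self[symmetric] assms ..
    then show ?thesis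
      by (simp only: of_real_eq_iff power2_eq_iff_nonneg norm_ge_zero)
  qed
  show ?thesis
  proof (cases "x = 0")
    case True
    then have "y = 0"
      using *[of y] by (simp add: norm_cinner)
    then show ?thesis
      using True by simp
  next
    case False
    then have yx: "cinner x y \<noteq> 0"
      using *[of x] by (auto simp: norm_cinner)
    have eq: "cinner x x *\<^sub>C x = cinner x y *\<^sub>C y"
      using fun_cong[OF assms, of x] by (simp add: rank_one_def)
    define c where "c = cinner x x / cinner x y"
    have "cmod c = 1"
      using *[of x] yx by (simp add: c_def norm_divide)
    have "c *\<^sub>C x = (1 / cinner x y) *\<^sub>C cinner x x *\<^sub>C x"
      by (simp add: c_def scaleC_scaleC)
    also have "\<dots> = y"
      unfolding eq using yx by (simp add: scaleC_scaleC scaleC_one)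
    finally show ?thesis
      using ray_scaleC[OF \<open>cmod c = 1\<close>] by metis
  qed
qed

text \<open>The value of \<open>ell v\<close> at \<open>rank_one x\<close> is the squared modulus of
  \<open>cinner v x\<close>. This yields the separation claim, and later identifies the points that
  survive in the compactness argument.\<close>

lemma separating_imp_ray_eq:
  assumes "separates_points_on Herm1 E ell"
    and "\<And>v. v \<in> E \<Longrightarrow> cmod (cinner v x) = cmod (cinner v y)"
  shows "ray x = ray y"
proof (rule ray_eq_if_rank_one_eq, rule ccontr)
  assume "rank_one x \<noteq> rank_one y"
  then obtain v where "v \<in> E" "ell v (rank_one x) \<noteq> ell v (rank_one y)"
    using assms(1) rank_one_in_Herm1 unfolding separates_points_on_def by blast
  then show False
    using assms(2) by (simp add: ell_def cinner_rank_one_self)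
qed


section \<open>Riesz representation and weak compactness of the unit ball\<close>

text \<open>By the parallelogram law a minimising sequence is Cauchy, because midpoints cannot be
  shorter than the infimum; completeness supplies the limit.\<close>

lemma ex_minimal_norm:
  fixes S :: "'a::complex_hilbert_space set"
  assumes "closed S" "S \<noteq> {}" and mid: "\<And>x y. x \<in> S \<Longrightarrow> y \<in> S \<Longrightarrow> (1/2) *\<^sub>R (x + y) \<in> S"
  shows "\<exists>x\<in>S. \<forall>y\<in>S. norm x \<le> norm y"
proof -
  define d where "d = (INF x\<in>S. (norm x)\<^sup>2)"
  have bdd: "bdd_below ((\<lambda>x. (norm x)\<^sup>2) ` S)"
    by (rule bdd_belowI2[of _ 0]) simp
  then have d: "d \<le> (norm x)\<^sup>2" if "x \<in> S" for x
    unfolding d_def using that by (rule cINF_lower)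
  have "\<exists>x\<in>S. (norm x)\<^sup>2 < d + inverse (Suc n)" for n
    using cINF_less_iff[OF \<open>S \<noteq> {}\<close> bdd, of "d + inverse (Suc n)"] by (simp add: d_def)
  then obtain X where X: "\<And>n. X n \<in> S" "\<And>n. (norm (X n))\<^sup>2 < d + inverse (Suc n)"
    by metis
  have close: "(norm (X m - X n))\<^sup>2 < 2 * inverse (Suc m) + 2 * inverse (Suc n)" for m n
  proof -
    have "4 * d \<le> (norm (X m + X n))\<^sup>2"
      using d[OF mid[OF X(1)[of m] X(1)[of n]]] by (simp add: power_divide)
    then show ?thesis
      using parallelogram_law[of "X m" "X n"] X(2)[of m] X(2)[of n] by argo
  qed
  have "Cauchy X"
  proof (rule metric_CauchyI)
    fix e :: real assume "0 < e"
    \<comment> \<open>Each of the two terms in \<open>close\<close> is then below half of the square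
      of \<open>e\<close>.\<close>
    then obtain N where N: "inverse (Suc N) < e\<^sup>2 / 4"
      using reals_Archimedean[of "e\<^sup>2 / 4"] by auto
    have "dist (X m) (X n) < e" if "m \<ge> N" "n \<ge> N" for m n
    proof -
      have "inverse (real (Suc m)) \<le> inverse (Suc N)" "inverse (real (Suc n)) \<le> inverse (Suc N)"
        using that by (simp_all add: le_imp_inverse_le)
      then have "(norm (X m - X n))\<^sup>2 < e\<^sup>2"
        using close[of m n] N by argo
      then show ?thesis
        using \<open>0 < e\<close> by (simp add: dist_norm power2_less_imp_less)
    qed
    then show "\<exists>M. \<forall>m\<ge>M. \<forall>n\<ge>M. dist (X m) (X n) < e"
      by blast
  qed
  then obtain x where x: "X \<longlonglongrightarrow> x"
    using Cauchy_convergent_iff convergent_def by blast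
  have "x \<in> S"
    using closed_sequentially[OF \<open>closed S\<close> X(1) x] .
  moreover have "(norm x)\<^sup>2 \<le> d"
  proof (rule LIMSEQ_le)
    show "(\<lambda>n. (norm (X n))\<^sup>2) \<longlonglongrightarrow> (norm x)\<^sup>2"
      by (intro tendsto_intros x)
    show "(\<lambda>n. d + inverse (Suc n)) \<longlonglongrightarrow> d"
      by (rule LIMSEQ_inverse_real_of_nat_add)
    show "\<exists>N. \<forall>n\<ge>N. (norm (X n))\<^sup>2 \<le> d + inverse (Suc n)"
      using X(2) less_imp_le by blast
  qed
  then have "\<forall>y\<in>S. norm x \<le> norm y"
    using d by (meson norm_ge_zero order_trans power2_le_imp_le)
  ultimately show ?thesis
    by blast
qed

text \<open>Subtracting from \<open>x\<close> its projection onto the line of \<open>u\<close>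
  lowers the squared norm by the squared modulus of \<open>cinner x u\<close> divided by the squared
  norm of \<open>u\<close>, so this modulus must vanish.\<close>

lemma cinner_zero_if_norm_minimal:
  fixes x u :: "'a::complex_inner"
  assumes min: "\<And>c. norm x \<le> norm (x - c *\<^sub>C u)"
  shows "cinner x u = 0"
proof (cases "u = 0")
  case False
  define r where "r = 1 / (norm u)\<^sup>2"
  have r: "0 < r" "r * (norm u)\<^sup>2 = 1"
    using False by (simp_all add: r_def)
  define c where "c = of_real r * cinner x u"
  have "(norm x)\<^sup>2 \<le> (norm (x - c *\<^sub>C u))\<^sup>2"
    using min by simp
  moreover have "(norm (c *\<^sub>C u))\<^sup>2 = (r * (norm u)\<^sup>2) * r * (cmod (cinner x u))\<^sup>2"
    using r(1) by (simp add: norm_scaleC c_def norm_mult power2_eq_square)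
  moreover have "cinner x (c *\<^sub>C u) = of_real (r * (cmod (cinner x u))\<^sup>2)"
    by (simp add: cinner_scaleC_right c_def of_real_cmod_square mult.commute mult.left_commute)
  ultimately have "r * (cmod (cinner x u))\<^sup>2 \<le> 0"
    by (simp add: norm_diff_square r(2))
  then show ?thesis
    using r(1) by (simp add: mult_le_0_iff)
qed simp

text \<open>The shortest vector \<open>x\<close> of the hyperplane \<open>f x = 1\<close> is
  orthogonal to the kernel of \<open>f\<close>. Since \<open>u - f u *\<^sub>C x\<close> lies in
  that kernel, \<open>x\<close> represents \<open>f\<close> after division by its squared
  norm.\<close>

lemma riesz_representation:
  fixes f :: "'a::complex_hilbert_space \<Rightarrow> complex"
  assumes "bounded_clinear f"
  shows "\<exists>y. \<forall>u. f u = cinner u y"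
proof (cases "\<forall>u. f u = 0")
  case True
  then show ?thesis
    by (intro exI[of _ 0]) simp
next
  case False
  interpret bounded_linear f
    using assms by (simp add: bounded_clinear_def)
  have sc: "f (c *\<^sub>C u) = c * f u" for c u
    using assms by (simp add: bounded_clinear_def scaleC_complex_def)
  obtain w where "f w \<noteq> 0"
    using False by blast
  then have "f ((1 / f w) *\<^sub>C w) = 1"
    by (simp add: sc)
  moreover have "closed {x. f x = 1}"
    by (intro closed_Collect_eq continuous_on_const linear_continuous_on bounded_linear_axioms)
  ultimately have "\<exists>x\<in>{x. f x = 1}. \<forall>y\<in>{x. f x = 1}. norm x \<le> norm y"
    by (intro ex_minimal_norm) (auto simp: add scaleR scaleR_conv_of_real)
  then obtain x where x: "f x = 1" and min: "\<And>y. f y = 1 \<Longrightarrow> norm x \<le> norm y"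
    by blast
  have orth: "cinner x u = 0" if "f u = 0" for u
    by (rule cinner_zero_if_norm_minimal, rule min) (simp add: diff sc x that)
  have "x \<noteq> 0"
    using x zero by auto
  have "f u = cinner u ((1 / (norm x)\<^sup>2) *\<^sub>R x)" for u
  proof -
    have "cinner x (u - f u *\<^sub>C x) = 0"
      by (rule orth) (simp add: diff sc x)
    then have "cinner (u - f u *\<^sub>C x) x = 0"
      by (metis cinner_commute complex_cnj_zero)
    then have "cinner u x = f u * of_real ((norm x)\<^sup>2)"
      by (simp add: cinner_diff_left cinner_scaleC_left norm_cinner)
    then show ?thesis
      using \<open>x \<noteq> 0\<close> by (simp add: cinner_scaleR_right)
  qed
  then show ?thesis
    by blast
qed

text \<open>Function types carry the topology of pointwise convergence, so this is weak compactness
  of the ball. The image consists of the linear functionals in a product of discs: linearity is a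
  closed condition, and Riesz provides the representing vectors.\<close>

lemma compact_weak_ball:
  "compact ((\<lambda>x u. cinner u x) ` cball 0 1 :: ('a::complex_hilbert_space \<Rightarrow> complex) set)"
proof -
  let ?P = "PiE UNIV (\<lambda>u::'a. cball (0::complex) (norm u))"
  let ?L = "{f::'a \<Rightarrow> complex. (\<forall>u w. f (u + w) = f u + f w) \<and> (\<forall>c u. f (c *\<^sub>C u) = c * f u)}"
  have "compactin (product_topology (\<lambda>_. euclidean) UNIV) ?P"
    by (simp add: compactin_PiE)
  then have "compact ?P"
    by (simp add: euclidean_product_topology)
  moreover have "closed ?L"
    by (intro closed_Collect_conj closed_Collect_all closed_Collect_eq continuous_intros
        continuous_on_product_coordinates)
  ultimately have "compact (?P \<inter> ?L)"
    by (rule compact_Int_closed)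
  also have "?P \<inter> ?L = (\<lambda>x u. cinner u x) ` cball 0 1"
  proof
    show "?P \<inter> ?L \<subseteq> (\<lambda>x u. cinner u x) ` cball 0 1"
    proof
      fix f assume f: "f \<in> ?P \<inter> ?L"
      then have bd: "cmod (f u) \<le> norm u" for u
        by (auto simp: PiE_iff)
      have add: "f (u + w) = f u + f w" and sc: "f (c *\<^sub>C u) = c * f u" for u w c
        using f by blast+
      have "bounded_linear f"
        by (rule bounded_linear_intro[of _ 1])
           (simp_all add: add bd scaleC_of_real[symmetric] sc scaleC_complex_def)
      then have "bounded_clinear f"
        by (simp add: bounded_clinear_def sc scaleC_complex_def)
      then obtain y where y: "\<And>u. f u = cinner u y"
        using riesz_representation by blast
      \<comment> \<open>Testing the bound on the representing vector itself places it in the unit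
        ball.\<close>
      have "(norm y)\<^sup>2 \<le> norm y"
        using bd[of y] by (simp add: y norm_cinner norm_power)
      then have "y \<in> cball 0 1"
        by (cases "y = 0") (auto simp: power2_eq_square)
      moreover have "f = (\<lambda>u. cinner u y)"
        using y by blast
      ultimately show "f \<in> (\<lambda>x u. cinner u x) ` cball 0 1"
        by blast
    qed
  next
    show "(\<lambda>x u. cinner u x) ` cball 0 1 \<subseteq> ?P \<inter> ?L"
    proof clarify
      fix x :: 'a assume "x \<in> cball 0 1"
      then have "cmod (cinner u x) \<le> norm u" for u
        using cmod_cinner_le[of u x] mult_left_mono[of "norm x" 1 "norm u"] by simp
      then show "(\<lambda>u. cinner u x) \<in> ?P \<inter> ?L"
        by (auto simp: cinner_add_left cinner_scaleC_left)
    qed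
  qed
  finally show ?thesis .
qed


section \<open>Comparison of topologies\<close>

text \<open>\<open>?D\<close> collects the functionals violating the conclusion. No point of the
  weak ball in \<open>?D\<close> meets all constraints \<open>?C\<close>, so by the finite
  intersection property finitely many constraints already exclude \<open>?D\<close>. The constraints
  use a nonstrict inequality in order to be closed.\<close>

lemma finitely_many_moduli_control:
  fixes E :: "'a::complex_hilbert_space set"
  assumes sep: "separates_points_on Herm1 E ell" and x0: "norm x0 = 1" and "r < 1"
  shows "\<exists>I. finite I \<and> I \<subseteq> E \<times> {0<..} \<and>
    (\<forall>x. norm x \<le> 1 \<longrightarrow> (\<forall>(v, e)\<in>I. \<bar>cmod (cinner v x) - cmod (cinner v x0)\<bar> < e) \<longrightarrow>
      r < cmod (cinner x0 x))"
proof -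
  let ?K = "(\<lambda>x u. cinner u x) ` cball 0 1 :: ('a \<Rightarrow> complex) set"
  let ?D = "{f. cmod (f x0) \<le> r} :: ('a \<Rightarrow> complex) set"
  let ?C = "\<lambda>(v, e). {f. \<bar>cmod (f v) - cmod (cinner v x0)\<bar> \<le> e} :: ('a \<Rightarrow> complex) set"
  have "closed ?D"
    by (intro closed_Collect_le continuous_intros continuous_on_product_coordinates)
  then have cpt: "compact (?K \<inter> ?D)"
    by (rule compact_Int_closed[OF compact_weak_ball])
  have cl: "closed (?C i)" for i
    by (cases i) (auto intro!: closed_Collect_le continuous_intros continuous_on_product_coordinates)
  have empty: "?K \<inter> ?D \<inter> (\<Inter>i\<in>E \<times> {0<..}. ?C i) = {}"
  proof (rule ccontr)
    assume "?K \<inter> ?D \<inter> (\<Inter>i\<in>E \<times> {0<..}. ?C i) \<noteq> {}"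
    then obtain f where "f \<in> ?K \<inter> ?D \<inter> (\<Inter>i\<in>E \<times> {0<..}. ?C i)"
      unfolding ex_in_conv[symmetric] ..
    then have f: "f \<in> ?K" "f \<in> ?D" and fC: "\<And>i. i \<in> E \<times> {0<..} \<Longrightarrow> f \<in> ?C i"
      by (simp_all only: Int_iff INT_iff)
    then obtain y where y: "f = (\<lambda>u. cinner u y)"
      by blast
    have "ray y = ray x0"
    proof (rule separating_imp_ray_eq[OF sep])
      fix v assume "v \<in> E"
      \<comment> \<open>Every tolerance occurs among the indices, so the moduli agree
        exactly.\<close>
      then have "\<bar>cmod (cinner v y) - cmod (cinner v x0)\<bar> \<le> e" if "0 < e" for e
        using fC[of "(v, e)"] that by (simp add: y)
      then have "\<bar>cmod (cinner v y) - cmod (cinner v x0)\<bar> \<le> 0"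
        by (rule field_le_epsilon) (simp only: add_0_left)
      then show "cmod (cinner v y) = cmod (cinner v x0)"
        by simp
    qed
    then have "cmod (cinner x0 y) = cmod (cinner x0 x0)"
      by (metis h_fun_ray)
    then show False
      using f(2) \<open>r < 1\<close> x0 by (simp add: y norm_cinner)
  qed
  have "\<exists>I. finite I \<and> I \<subseteq> E \<times> {0<..} \<and> ?K \<inter> ?D \<inter> (\<Inter>i\<in>I. ?C i) = {}"
    using compact_imp_fip_image[of "?K \<inter> ?D" "E \<times> {0<..}" ?C, OF cpt cl] empty by meson
  then obtain I where I: "finite I" "I \<subseteq> E \<times> {0<..}" "?K \<inter> ?D \<inter> (\<Inter>i\<in>I. ?C i) = {}"
    by (elim exE conjE)
  show ?thesis
  proof (intro exI[of _ I] conjI I allI impI)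
    fix x assume x: "norm x \<le> 1"
      and close: "\<forall>(v, e)\<in>I. \<bar>cmod (cinner v x) - cmod (cinner v x0)\<bar> < e"
    let ?f = "\<lambda>u. cinner u x"
    have K: "?f \<in> ?K"
      using x by (intro imageI) simp
    have C: "?f \<in> (\<Inter>i\<in>I. ?C i)"
      using close by (force intro: less_imp_le)
    have "?f \<notin> ?D"
    proof
      assume "?f \<in> ?D"
      with K have "?f \<in> ?K \<inter> ?D \<inter> (\<Inter>i\<in>I. ?C i)"
        by (intro IntI C)
      then show False
        unfolding I(3) by (rule emptyE)
    qed
    then show "r < cmod (cinner x0 x)"
      by simp
  qed
qed

lemma openin_proj_topology:
  "openin proj_topology U \<longleftrightarrow> U \<subseteq> proj_space \<and> openin (top_of_set (sphere 0 1)) {x \<in> sphere 0 1. ray x \<in> U}"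
  by (simp add: proj_topology_def openin_quotient_topology proj_space_def)

text \<open>Composed with \<open>ray\<close>, each \<open>h_fun v\<close> is a continuous function
  on the sphere, so every subbasic set is open in the quotient.\<close>

lemma openin_proj_topology_if_initial:
  fixes E :: "'a::complex_hilbert_space set"
  assumes "openin (initial_topology proj_space E h_fun) U"
  shows "openin proj_topology U"
proof -
  have basis: "openin proj_topology S"
    if S: "S \<in> insert proj_space {proj_space \<inter> h_fun v -` U | v U. v \<in> E \<and> open U}"
    for S :: "'a set set"
  proof -
    consider "S = proj_space" | v U where "S = proj_space \<inter> h_fun v -` U" "open U"
      using S by blast
    then show ?thesis
    proof cases
      case 1
      have "{x \<in> sphere 0 1. ray x \<in> proj_space} = sphere (0::'a) 1"
        by (auto simp: proj_space_def)
      then show ?thesis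
        by (simp add: 1 openin_proj_topology)
    next
      case 2
      have "{x \<in> sphere 0 1. ray x \<in> S} = sphere 0 1 \<inter> (\<lambda>x. cmod (cinner v x)) -` U"
        by (auto simp: 2 proj_space_def h_fun_ray)
      moreover have "continuous_on (sphere 0 1) (\<lambda>x. cmod (cinner v x))"
        by (intro continuous_intros linear_continuous_on bounded_linear_cinner_right)
      ultimately show ?thesis
        using continuous_openin_preimage_gen[OF _ \<open>open U\<close>] by (auto simp: 2 openin_proj_topology)
    qed
  qed
  have "generate_topology_on (insert proj_space {proj_space \<inter> h_fun v -` U | v U. v \<in> E \<and> open U}) U"
    using assms unfolding initial_topology_def by (rule openin_topology_generated_by)
  then show ?thesis
    by (induction rule: generate_topology_on.induct) (use basis in auto)
qed

lemma openin_initial_if_proj_topology: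
  fixes E :: "'a::complex_hilbert_space set"
  assumes sep: "separates_points_on Herm1 E ell" and U: "openin proj_topology U"
  shows "openin (initial_topology proj_space E h_fun) U"
proof (subst openin_subopen, rule ballI)
  let ?T = "initial_topology proj_space E h_fun"
  fix p assume "p \<in> U"
  from U have "U \<subseteq> proj_space" and opn: "openin (top_of_set (sphere 0 1)) {x \<in> sphere 0 1. ray x \<in> U}"
    by (auto simp: openin_proj_topology)
  with \<open>p \<in> U\<close> obtain x0 where x0: "norm x0 = 1" "p = ray x0"
    by (auto simp: proj_space_def)
  with \<open>p \<in> U\<close> have "x0 \<in> {x \<in> sphere 0 1. ray x \<in> U}"
    by simp
  moreover have "\<forall>x\<in>{x \<in> sphere 0 1. ray x \<in> U}.
      \<exists>e>0. \<forall>x'\<in>sphere 0 1. dist x' x < e \<longrightarrow> x' \<in> {x \<in> sphere 0 1. ray x \<in> U}"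
    using opn unfolding openin_euclidean_subtopology_iff by (rule conjunct2)
  ultimately obtain e where "e > 0"
    "\<forall>x\<in>sphere 0 1. dist x x0 < e \<longrightarrow> x \<in> {x \<in> sphere 0 1. ray x \<in> U}"
    by blast
  then have e: "e > 0" "\<And>x. norm x = 1 \<Longrightarrow> dist x x0 < e \<Longrightarrow> ray x \<in> U"
    by simp_all
  \<comment> \<open>For unit vectors with phases aligned by \<open>c\<close>, the squared distance
    from \<open>c *\<^sub>C x\<close> to \<open>x0\<close> is
    \<open>2 - 2 * cmod (cinner x0 x)\<close>; exceeding \<open>r\<close> means being closer than
    \<open>e\<close>.\<close>
  define r where "r = 1 - e\<^sup>2 / 2"
  have "r < 1"
    using e(1) by (simp add: r_def)
  obtain I where "finite I \<and> I \<subseteq> E \<times> {0<..} \<and>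
    (\<forall>x. norm x \<le> 1 \<longrightarrow> (\<forall>(v, e)\<in>I. \<bar>cmod (cinner v x) - cmod (cinner v x0)\<bar> < e) \<longrightarrow>
      r < cmod (cinner x0 x))"
    using finitely_many_moduli_control[OF sep x0(1) \<open>r < 1\<close>] by (rule exE)
  then have I: "finite I" "I \<subseteq> E \<times> {0<..}"
    and ctrl: "\<And>x. norm x \<le> 1 \<Longrightarrow>
      \<forall>(v, e)\<in>I. \<bar>cmod (cinner v x) - cmod (cinner v x0)\<bar> < e \<Longrightarrow> r < cmod (cinner x0 x)"
    by simp_all
  define N where "N = (\<lambda>(v, e). proj_space \<inter> h_fun v -` ball (h_fun v p) e)"
  \<comment> \<open>Inserting \<open>proj_space\<close> keeps \<open>W\<close> within the space of
    rays even when \<open>I\<close> is empty.\<close>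
  define W where "W = \<Inter>(insert proj_space (N ` I))"
  have "openin ?T W"
    unfolding W_def
  proof (rule openin_Inter)
    have "N (v, e) \<in> {proj_space \<inter> h_fun v -` U | v U. v \<in> E \<and> open U}" if "v \<in> E" for v e
      using that open_ball unfolding N_def case_prod_conv by blast
    then show "openin ?T S" if "S \<in> insert proj_space (N ` I)" for S
      unfolding initial_topology_def using that I(2)
      by (intro topology_generated_by_Basis) auto
  qed (use I(1) in auto)
  moreover have "p \<in> W"
    using \<open>p \<in> U\<close> \<open>U \<subseteq> proj_space\<close> I(2) by (auto simp: W_def N_def)
  moreover have "W \<subseteq> U"
  proof
    fix q assume q: "q \<in> W"
    then obtain x where x: "norm x = 1" "q = ray x"
      by (auto simp: W_def proj_space_def)
    have "r < cmod (cinner x0 x)"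
    proof (rule ctrl, simp add: x, clarify)
      fix v e assume "(v, e) \<in> I"
      then have "q \<in> N (v, e)"
        using q by (auto simp: W_def)
      then show "\<bar>cmod (cinner v x) - cmod (cinner v x0)\<bar> < e"
        by (simp add: N_def x x0 h_fun_ray dist_real_def abs_minus_commute)
    qed
    \<comment> \<open>Changing \<open>x\<close> by a phase keeps the ray \<open>q\<close>, so the
      representative nearest to \<open>x0\<close> may be used.\<close>
    moreover obtain c where c: "cmod c = 1" "c * cinner x x0 = of_real (cmod (cinner x x0))"
      using ex_phase by blast
    ultimately have "(norm (c *\<^sub>C x - x0))\<^sup>2 < e\<^sup>2"
      by (simp add: norm_diff_square norm_scaleC cinner_scaleC_left x x0 r_def
          cmod_cinner_commute[of x0])
    then have "dist (c *\<^sub>C x) x0 < e"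
      using e(1) by (simp add: dist_norm power2_less_imp_less)
    then have "ray (c *\<^sub>C x) \<in> U"
      using e(2) c(1) x(1) by (simp add: norm_scaleC)
    then show "q \<in> U"
      by (simp add: ray_scaleC c(1) x(2))
  qed
  ultimately show "\<exists>W. openin ?T W \<and> p \<in> W \<and> W \<subseteq> U"
    by blast
qed

theorem proposition3p10:
  fixes E :: "'a::complex_hilbert_space set"
  assumes "separates_points_on Herm1 E ell"
  shows "separates_points_on closed_proj_space E h_fun \<and>
    proj_topology = initial_topology proj_space E h_fun"
proof
  show "separates_points_on closed_proj_space E h_fun"
    unfolding separates_points_on_def
  proof (intro ballI impI)
    fix p q :: "'a set"
    assume "p \<in> closed_proj_space" "q \<in> closed_proj_space" "p \<noteq> q"
    then obtain x y where "p = ray x" "q = ray y" "ray x \<noteq> ray y"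
      by (auto simp: closed_proj_space_def)
    then show "\<exists>v\<in>E. h_fun v p \<noteq> h_fun v q"
      using separating_imp_ray_eq[OF assms, of x y] by (auto simp: h_fun_ray)
  qed
  show "proj_topology = initial_topology proj_space E h_fun"
    unfolding topology_eq
    by (intro allI iffI; erule openin_proj_topology_if_initial openin_initial_if_proj_topology[OF assms])
qed

end
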